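(* Let $\alpha\in(0,1)$. Let $U$, $S_1^{-\alpha}(\alpha)$ and $G(\alpha+1)$ be independent random variables, where $U$ is uniform on $(0,1)$, $G(\alpha+1)$ is a gamma random variable of parameter $\alpha+1$, and $S_1^{-\alpha}(\alpha)$ has the length-biased distribution of $S(\alpha)^{-\alpha}$, with $S(\alpha)$ a positive $\alpha$-stable random variable. Then $$U\,S_1^{-\alpha}(\alpha)\,G(\alpha+1)^{\alpha}\stackrel{(d)}{=}\mathbf{e},$$ where $\mathbf{e}$ is an exponential random variable of parameter $1$.
   Context: $S(\alpha)$ is the random variable on $(0,\infty)$ with Laplace transform $\mathbb{E}[e^{-\lambda S(\alpha)}]=e^{-\lambda^\alpha}$, $\lambda\ge0$; with this normalization $\mathbb{E}[S(\alpha)^{-\alpha n}]=\Gamma(n+1)/\Gamma(\alpha n+1)$ for $n=1,2,\ldots$. The notation $S_1^{-\alpha}(\alpha)$ stands for a single random variable whose law is the length-biased distribution of $S(\alpha)^{-\alpha}$: for every measurable $g:[0,\infty)\to[0,\infty)$, $$\mathbb{E}\big[g(S_1^{-\alpha}(\alpha))\big]=\frac{\mathbb{E}\big[S(\alpha)^{-\alpha}\,g(S(\alpha)^{-\alpha})\big]}{\mathbb{E}[S(\alpha)^{-\alpha}]}.$$ A gamma random variable $G(a)$ of parameter $a>0$ has density $x^{a-1}e^{-x}/\Gamma(a)$ on $(0,\infty)$. The symbol $\stackrel{(d)}{=}$ denotes equality in distribution. *)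

theory Defs
  imports "HOL-Probability.Probability"
begin

(* Normalization: the Laplace exponent is exactly l^alpha, with no scale constant. *)
definition positive_stable :: "real \<Rightarrow> 'a measure \<Rightarrow> ('a \<Rightarrow> real) \<Rightarrow> bool" where
  "positive_stable \<alpha> N S \<longleftrightarrow>
     S \<in> borel_measurable N \<and> (AE x in N. 0 < S x) \<and>
     (\<forall>l\<ge>0. (\<integral>x. exp (- l * S x) \<partial>N) = exp (- (l powr \<alpha>)))"

(* Y on M has the length-biased distribution of the nonnegative variable X on N.
   Expectations are nonnegative integrals, as they may be infinite.  Test functions on
   [0,oo) are taken as nonnegative Borel functions on the whole line: g = indicator {..<0}
   shows that Y is almost surely nonnegative. *)
definition length_biased ::
    "'a measure \<Rightarrow> ('a \<Rightarrow> real) \<Rightarrow> 'b measure \<Rightarrow> ('b \<Rightarrow> real) \<Rightarrow> bool" where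
  "length_biased M Y N X \<longleftrightarrow>
     Y \<in> borel_measurable M \<and> X \<in> borel_measurable N \<and> (AE x in N. 0 \<le> X x) \<and>
     (\<forall>g :: real \<Rightarrow> real. g \<in> borel_measurable borel \<longrightarrow> (\<forall>x. 0 \<le> g x) \<longrightarrow>
        (\<integral>\<^sup>+x. ennreal (g (Y x)) \<partial>M) =
        (\<integral>\<^sup>+x. ennreal (X x * g (X x)) \<partial>N) / (\<integral>\<^sup>+x. ennreal (X x) \<partial>N))"

definition gamma_density :: "real \<Rightarrow> real \<Rightarrow> real" where
  "gamma_density a x = (if 0 < x then x powr (a - 1) * exp (- x) / Gamma a else 0)"

end

theory Submission
  imports Defs
begin

text \<open>Put \<open>X = S\<^sup>-\<^sup>\<alpha>\<close>. The density of \<open>G(\<alpha>+1)\<close> is proportional to \<open>w\<^sup>\<alpha> e\<^sup>-\<^sup>w\<close>, so \<open>Y G(\<alpha>+1)\<^sup>\<alpha>\<close> is the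
  length-biased version of \<open>W = X E\<^sup>\<alpha>\<close> with \<open>E\<close> standard exponential and independent of \<open>X\<close>.
  Multiplying a length-biased variable by an independent uniform one yields a density
  proportional to the tail of \<open>W\<close>, and
  \<open>P(W > x) = P(E > S x\<^sup>1\<^sup>/\<^sup>\<alpha>) = \<^bold>E exp (- S x\<^sup>1\<^sup>/\<^sup>\<alpha>) = e\<^sup>-\<^sup>x\<close> is read off the Laplace transform of \<open>S\<close>.
  The normalizing constant is never computed: both sides are probability measures.\<close>

text \<open>Independence makes the joint law a finite product measure, and the coordinates are then
  integrated out one at a time. \<open>A\<close> is innermost because the uniform factor will be
  averaged first, with the other two values fixed.\<close>

lemma (in prob_space) nn_integral_indep_triple:
  fixes A B C :: "'a \<Rightarrow> real" and f :: "real \<times> real \<times> real \<Rightarrow> ennreal"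
  assumes indep: "indep_vars (\<lambda>_. borel) (\<lambda>i. [A, B, C] ! i) {..<3}"
    and f [measurable]: "f \<in> borel_measurable (borel \<Otimes>\<^sub>M borel \<Otimes>\<^sub>M borel)"
  shows "(\<integral>\<^sup>+\<omega>. f (A \<omega>, B \<omega>, C \<omega>) \<partial>M) =
    (\<integral>\<^sup>+b. \<integral>\<^sup>+c. \<integral>\<^sup>+a. f (a, b, c) \<partial>distr M borel A \<partial>distr M borel C \<partial>distr M borel B)"
proof -
  \<comment> \<open>\<open>[A, B, C] ! i\<close> is unspecified for i \<ge> 3. The constant 0 fills
    those indices because the product locale wants a probability measure at every index.\<close>
  define Z where "Z i = (if i < 3 then [A, B, C] ! i else (\<lambda>_. 0))" for i :: nat
  define D where "D i = distr M borel (Z i)" for i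
  have rv: "random_variable borel ([A, B, C] ! i)" if "i < 3" for i
    using indep that unfolding indep_vars_def by auto
  have Z [measurable]: "random_variable borel (Z i)" for i
    using rv by (auto simp: Z_def)
  have Z_simps: "Z 0 = A" "Z 1 = B" "Z 2 = C"
    by (simp_all add: Z_def)
  have indepZ: "indep_vars (\<lambda>_. borel) Z {..<3}"
    using indep by (subst indep_vars_cong[of _ "{..<3}" Z "\<lambda>i. [A, B, C] ! i"]) (auto simp: Z_def)
  have joint: "distr M (Pi\<^sub>M {..<3} (\<lambda>_. borel)) (\<lambda>\<omega>. \<lambda>i\<in>{..<3}. Z i \<omega>) = Pi\<^sub>M {..<3} D"
    using indepZ unfolding D_def
    by (subst (asm) indep_vars_iff_distr_eq_PiM) (auto simp: lessThan_empty_iff)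
  interpret P: product_prob_space D "{..<3::nat}"
    unfolding D_def by (intro product_prob_spaceI prob_space_distr Z)
  \<comment> \<open>The nesting fixes the order of peeling: coordinate 1 becomes the outermost
    integral, then 2, and 0 remains as the singleton.\<close>
  have I: "{..<3::nat} = insert 1 (insert 2 {0})" by auto
  have sets_D [measurable_cong]: "sets (D i) = sets borel" for i
    by (simp add: D_def)
  have "(\<integral>\<^sup>+\<omega>. f (A \<omega>, B \<omega>, C \<omega>) \<partial>M) =
      (\<integral>\<^sup>+x. f (x 0, x 1, x 2)
        \<partial>distr M (Pi\<^sub>M {..<3} (\<lambda>_. borel)) (\<lambda>\<omega>. \<lambda>i\<in>{..<3}. Z i \<omega>))"
    by (subst nn_integral_distr) (auto simp: Z_simps[unfolded One_nat_def])
  also have "\<dots> = (\<integral>\<^sup>+x. f (x 0, x 1, x 2) \<partial>Pi\<^sub>M (insert 1 (insert 2 {0})) D)"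
    by (simp only: joint flip: I)
  also have "\<dots> = (\<integral>\<^sup>+b. \<integral>\<^sup>+x. f (x 0, b, x 2) \<partial>Pi\<^sub>M (insert 2 {0}) D \<partial>D 1)"
    by (subst P.product_nn_integral_insert_rev) auto
  also have "\<dots> = (\<integral>\<^sup>+b. \<integral>\<^sup>+c. \<integral>\<^sup>+x. f (x 0, b, c) \<partial>Pi\<^sub>M {0} D \<partial>D 2 \<partial>D 1)"
    by (intro nn_integral_cong, subst P.product_nn_integral_insert_rev) auto
  also have "\<dots> = (\<integral>\<^sup>+b. \<integral>\<^sup>+c. \<integral>\<^sup>+a. f (a, b, c) \<partial>D 0 \<partial>D 2 \<partial>D 1)"
    by (intro nn_integral_cong P.product_nn_integral_singleton) auto
  finally show ?thesis
    by (simp add: D_def Z_simps[unfolded One_nat_def])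
qed

text \<open>Indicators of Borel sets as test functions already determine the law. The density form
  lets integrals against the law of \<open>Y\<close> be pulled back to \<open>N\<close>.\<close>

lemma distr_length_biased:
  assumes "length_biased M Y N X"
  shows "distr M borel Y =
    density (distr N borel X) (\<lambda>x. ennreal x / (\<integral>\<^sup>+x. ennreal (X x) \<partial>N))"
proof (rule measure_eqI)
  have [measurable]: "Y \<in> borel_measurable M" "X \<in> borel_measurable N"
    and nonneg: "AE x in N. 0 \<le> X x"
    and lb: "\<And>g :: real \<Rightarrow> real. g \<in> borel_measurable borel \<Longrightarrow> (\<forall>x. 0 \<le> g x) \<Longrightarrow>
      (\<integral>\<^sup>+x. ennreal (g (Y x)) \<partial>M) =
      (\<integral>\<^sup>+x. ennreal (X x * g (X x)) \<partial>N) / (\<integral>\<^sup>+x. ennreal (X x) \<partial>N)"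
    using assms unfolding length_biased_def by auto
  fix A :: "real set" assume "A \<in> sets (distr M borel Y)"
  then have A [measurable]: "A \<in> sets borel" by simp
  have "emeasure (distr M borel Y) A = (\<integral>\<^sup>+x. indicator A x \<partial>distr M borel Y)"
    by simp
  also have "\<dots> = (\<integral>\<^sup>+x. ennreal (indicator A (Y x)) \<partial>M)"
    by (subst nn_integral_distr) (auto simp: ennreal_indicator)
  also have "\<dots> = (\<integral>\<^sup>+x. ennreal (X x * indicator A (X x)) \<partial>N) / (\<integral>\<^sup>+x. ennreal (X x) \<partial>N)"
    by (rule lb) auto
  also have "\<dots> = (\<integral>\<^sup>+x. ennreal (X x) / (\<integral>\<^sup>+x. ennreal (X x) \<partial>N) * indicator A (X x) \<partial>N)"
    \<comment> \<open>Division is multiplication by the inverse in \<open>ennreal\<close>, so the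
      constant moves under the integral whatever the value of the mean.\<close>
    unfolding divide_ennreal_def
    by (subst nn_integral_multc[symmetric])
       (auto intro!: nn_integral_cong simp: indicator_def split: if_splits)
  also have "\<dots> = emeasure (density (distr N borel X)
      (\<lambda>x. ennreal x / (\<integral>\<^sup>+x. ennreal (X x) \<partial>N))) A"
    by (simp add: emeasure_density nn_integral_distr)
  finally show "emeasure (distr M borel Y) A = \<dots>" .
qed simp

text \<open>Substitute x = u k: the weight k cancels the density 1/k of the uniform law on (0,k).
  This is how size biasing followed by a uniform factor produces a tail probability. For k = 0 both
  sides vanish.\<close>

lemma nn_integral_uniform_scale:
  fixes f :: "real \<Rightarrow> ennreal" and k :: real
  assumes [measurable]: "f \<in> borel_measurable borel" and "0 \<le> k"
  shows "ennreal k * (\<integral>\<^sup>+u. f (u * k) \<partial>uniform_measure lborel {0<..<1}) =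
    (\<integral>\<^sup>+x. f x * indicator {0<..<k} x \<partial>lborel)"
proof (cases "k = 0")
  case False
  with \<open>0 \<le> k\<close> have k: "k > 0" by simp
  have "(\<integral>\<^sup>+x. f x * indicator {0<..<k} x \<partial>lborel) =
      ennreal k * (\<integral>\<^sup>+u. f (0 + k * u) * indicator {0<..<k} (0 + k * u) \<partial>lborel)"
    using k by (subst nn_integral_real_affine[where c = k and t = 0]) auto
  also have "(\<integral>\<^sup>+u. f (0 + k * u) * indicator {0<..<k} (0 + k * u) \<partial>lborel) =
      (\<integral>\<^sup>+u. f (u * k) * indicator {0<..<1} u \<partial>lborel)"
    using k by (intro nn_integral_cong)
      (auto simp: indicator_def mult.commute zero_less_mult_iff mult_less_cancel_left1)
  also have "\<dots> = (\<integral>\<^sup>+u. f (u * k) \<partial>uniform_measure lborel {0<..<1})"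
    by (subst nn_integral_uniform_measure) (auto simp: divide_ennreal_def)
  finally show ?thesis ..
qed simp

lemma nn_integral_exp_tail:
  fixes a :: real
  shows "(\<integral>\<^sup>+w. ennreal (exp (- w)) * indicator {a<..} w \<partial>lborel) = ennreal (exp (- a))"
proof -
  have "(\<integral>\<^sup>+w. ennreal (exp (- w)) * indicator {a<..} w \<partial>lborel) =
      (\<integral>\<^sup>+w. ennreal (exp (- w)) * indicator {a..} w \<partial>lborel)"
    by (rule nn_integral_cong_AE, use AE_lborel_singleton[of a] in eventually_elim)
       (auto simp: indicator_def)
  also have "\<dots> = ennreal (0 - (- exp (- a)))"
  proof (rule nn_integral_FTC_atLeast)
    show "((\<lambda>w::real. - exp (- w)) \<longlongrightarrow> 0) at_top"
      using tendsto_minus[OF filterlim_compose[OF exp_at_bot filterlim_uminus_at_bot_at_top]] by simp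
  qed (auto intro!: derivative_eq_intros)
  finally show ?thesis by simp
qed

lemma nn_integral_stable_exp_tail:
  fixes \<alpha> x :: real
  assumes S: "positive_stable \<alpha> N S" and N: "prob_space N" and "0 < \<alpha>" "0 < x"
  shows "(\<integral>\<^sup>+s. \<integral>\<^sup>+w. ennreal (exp (- w)) * indicator {0<..} w *
      indicator {0<..<S s powr - \<alpha> * w powr \<alpha>} x \<partial>lborel \<partial>N) = ennreal (exp (- x))"
proof -
  have [measurable]: "S \<in> borel_measurable N" and pos: "AE s in N. 0 < S s"
    and laplace: "\<And>l. 0 \<le> l \<Longrightarrow> (\<integral>s. exp (- l * S s) \<partial>N) = exp (- (l powr \<alpha>))"
    using S unfolding positive_stable_def by auto
  interpret prob_space N by fact
  \<comment> \<open>The Laplace variable: since l powr \<alpha> = x, the condition on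
    \<open>x\<close> becomes l s < w, and the exponential tail beyond l s is exp (- l s).\<close>
  define l where "l = x powr (1 / \<alpha>)"
  have l: "0 < l" "l powr \<alpha> = x"
    using assms by (auto simp: l_def powr_powr)
  have "(\<integral>\<^sup>+w. ennreal (exp (- w)) * indicator {0<..} w *
      indicator {0<..<s powr - \<alpha> * w powr \<alpha>} x \<partial>lborel) = ennreal (exp (- l * s))"
    if "0 < s" for s
  proof -
    have "x < s powr - \<alpha> * w powr \<alpha> \<longleftrightarrow> l * s < w" if "0 < w" for w
    proof -
      have "x < s powr - \<alpha> * w powr \<alpha> \<longleftrightarrow> l powr \<alpha> < (w / s) powr \<alpha>"
        using \<open>0 < s\<close> \<open>0 < w\<close> by (simp add: l powr_minus powr_divide field_simps)
      also have "\<dots> \<longleftrightarrow> l < w / s"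
        using \<open>0 < s\<close> \<open>0 < w\<close> \<open>0 < \<alpha>\<close> l
        by (smt (verit) powr_less_mono2 powr_mono2 divide_pos_pos)
      also have "\<dots> \<longleftrightarrow> l * s < w"
        using \<open>0 < s\<close> by (simp add: field_simps)
      finally show ?thesis .
    qed
    moreover have "0 < l * s" using l that by simp
    ultimately have "(\<integral>\<^sup>+w. ennreal (exp (- w)) * indicator {0<..} w *
        indicator {0<..<s powr - \<alpha> * w powr \<alpha>} x \<partial>lborel) =
        (\<integral>\<^sup>+w. ennreal (exp (- w)) * indicator {l * s<..} w \<partial>lborel)"
      using \<open>0 < x\<close> by (intro nn_integral_cong) (auto simp: indicator_def)
    then show ?thesis by (simp add: nn_integral_exp_tail)
  qed
  then have "(\<integral>\<^sup>+s. \<integral>\<^sup>+w. ennreal (exp (- w)) * indicator {0<..} w *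
      indicator {0<..<S s powr - \<alpha> * w powr \<alpha>} x \<partial>lborel \<partial>N) =
      (\<integral>\<^sup>+s. ennreal (exp (- l * S s)) \<partial>N)"
    using pos by (intro nn_integral_cong_AE) auto
  \<comment> \<open>The transform in \<open>positive_stable\<close> is a Bochner integral; the
    integrand is almost surely at most 1, hence integrable.\<close>
  also have "\<dots> = ennreal (\<integral>s. exp (- l * S s) \<partial>N)"
  proof (rule nn_integral_eq_integral)
    show "integrable N (\<lambda>s. exp (- l * S s))"
      using pos l by (intro integrable_const_bound[where B = 1]) auto
  qed auto
  finally show ?thesis using l laplace[of l] by simp
qed

theorem mainTheorem4:
  fixes \<alpha> :: real
    and M :: "'a measure" and U Y G :: "'a \<Rightarrow> real"
    and N :: "'b measure" and S :: "'b \<Rightarrow> real"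
    and L :: "'c measure" and e :: "'c \<Rightarrow> real"
  assumes alpha: "0 < \<alpha>" "\<alpha> < 1"
    and spaces: "prob_space M" "prob_space N" "prob_space L"
    and S: "positive_stable \<alpha> N S"
    and indep: "prob_space.indep_vars M (\<lambda>_. borel) (\<lambda>i. [U, Y, G] ! i) {..<3}"
    and U: "distr M lborel U = uniform_measure lborel {0<..<1}"
    and Y: "length_biased M Y N (\<lambda>x. S x powr (- \<alpha>))"
    and G: "distributed M lborel G (gamma_density (\<alpha> + 1))"
    and e: "distributed L lborel e (exponential_density 1)"
  shows "distr M borel (\<lambda>\<omega>. U \<omega> * Y \<omega> * G \<omega> powr \<alpha>) = distr L borel e"
proof -
  interpret M: prob_space M by fact
  interpret N: prob_space N by fact
  interpret L: prob_space L by fact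
  interpret NL: pair_sigma_finite N lborel ..
  have rv: "[U, Y, G] ! i \<in> borel_measurable M" if "i < 3" for i
    using indep that unfolding M.indep_vars_def by auto
  have [measurable]: "U \<in> borel_measurable M"
    using rv[of 0] by simp
  have [measurable]: "S \<in> borel_measurable N"
    using S unfolding positive_stable_def by auto
  have [measurable]: "Y \<in> borel_measurable M"
    using Y unfolding length_biased_def by auto
  have [measurable]: "G \<in> borel_measurable M" and [measurable]: "e \<in> borel_measurable L"
    using G e by (auto simp: distributed_def)
  have [measurable]: "gamma_density (\<alpha> + 1) \<in> borel_measurable borel"
    unfolding gamma_density_def by measurable
  have distr_U: "distr M borel U = uniform_measure lborel {0<..<1}"
    using U by (simp cong: distr_cong)
  have distr_G: "distr M borel G = density lborel (gamma_density (\<alpha> + 1))"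
    using G by (simp add: distributed_def cong: distr_cong)
  have distr_e: "distr L borel e = density lborel (exponential_density 1)"
    using e by (simp add: distributed_def cong: distr_cong)
  define W where "W = (\<lambda>\<omega>. U \<omega> * Y \<omega> * G \<omega> powr \<alpha>)"
  have [measurable]: "W \<in> borel_measurable M" unfolding W_def by measurable
  define m where "m = (\<integral>\<^sup>+s. ennreal (S s powr - \<alpha>) \<partial>N)"
  define c where "c = ennreal (1 / Gamma (\<alpha> + 1))"
  define E where "E w = ennreal (exp (- w)) * indicator {0<..} w" for w :: real
  have [measurable]: "E \<in> borel_measurable borel" unfolding E_def by measurable
  \<comment> \<open>The factor w powr \<alpha> is split off the gamma density as a size-biasing
    weight, leaving the standard exponential density \<open>E\<close> and the constant
    \<open>c\<close>.\<close>
  have gamma: "ennreal (gamma_density (\<alpha> + 1) w) = c * E w * ennreal (w powr \<alpha>)" for w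
    using alpha Gamma_real_pos[of "\<alpha> + 1"]
    by (simp add: gamma_density_def c_def E_def ennreal_mult[symmetric] mult_ac)
  have main: "emeasure (distr M borel W) A = c / m * emeasure (distr L borel e) A"
    if A [measurable]: "A \<in> sets borel" for A
  proof -
    let ?f = "indicator A :: real \<Rightarrow> ennreal"
    let ?\<U> = "uniform_measure lborel {0<..<1::real}"
    interpret U: prob_space ?\<U>
      by (rule prob_space_uniform_measure) auto
    have [measurable_cong]: "sets ?\<U> = sets borel" by simp
    define J where "J y w = (\<integral>\<^sup>+u. ?f (u * y * w powr \<alpha>) \<partial>?\<U>)" for y w
    have [measurable]: "case_prod J \<in> borel_measurable (borel \<Otimes>\<^sub>M borel)"
      unfolding J_def by measurable
    \<comment> \<open>Named as a function of both arguments so that joint measurability, required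
      for exchanging integrals, can be shown once through \<open>T_eq\<close>.\<close>
    define T :: "real \<Rightarrow> real \<Rightarrow> ennreal" where "T k x = indicator {0<..<k} x" for k x
    have T_eq: "T = (\<lambda>k x. if 0 < x \<and> x < k then 1 else 0)"
      by (simp add: T_def fun_eq_iff)
    have [measurable]: "case_prod T \<in> borel_measurable (borel \<Otimes>\<^sub>M borel)"
      unfolding T_eq by measurable
    \<comment> \<open>The two biasing weights, y from \<open>Y\<close> and w powr \<alpha> from
      \<open>G\<close>, combine into the single factor k = y * w powr \<alpha> that the uniform
      scaling consumes.\<close>
    have scale: "ennreal y * (\<integral>\<^sup>+w. c * E w * ennreal (w powr \<alpha>) * J y w \<partial>lborel) =
        c * (\<integral>\<^sup>+w. E w * (\<integral>\<^sup>+x. ?f x * T (y * w powr \<alpha>) x \<partial>lborel) \<partial>lborel)"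
      if "0 \<le> y" for y
    proof -
      have "E w * (\<integral>\<^sup>+x. ?f x * T (y * w powr \<alpha>) x \<partial>lborel) =
          ennreal y * (E w * ennreal (w powr \<alpha>) * J y w)" for w
      proof -
        have "(\<integral>\<^sup>+x. ?f x * T (y * w powr \<alpha>) x \<partial>lborel) =
            ennreal (y * w powr \<alpha>) * (\<integral>\<^sup>+u. ?f (u * (y * w powr \<alpha>)) \<partial>?\<U>)"
          using that unfolding T_def by (intro nn_integral_uniform_scale[symmetric]) auto
        also have "ennreal (y * w powr \<alpha>) = ennreal y * ennreal (w powr \<alpha>)"
          using that by (simp add: ennreal_mult)
        also have "(\<lambda>u. u * (y * w powr \<alpha>)) = (\<lambda>u. u * y * w powr \<alpha>)"
          by (simp add: mult.assoc)
        finally show ?thesis by (simp only: mult_ac J_def)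
      qed
      then show ?thesis
        by (simp add: nn_integral_cmult mult.assoc mult.left_commute[of c "ennreal y"])
    qed
    have "emeasure (distr M borel W) A = (\<integral>\<^sup>+x. ?f x \<partial>distr M borel W)"
      by simp
    also have "\<dots> = (\<integral>\<^sup>+\<omega>. ?f (U \<omega> * Y \<omega> * G \<omega> powr \<alpha>) \<partial>M)"
      by (subst nn_integral_distr) (auto simp: W_def)
    also have "\<dots> = (\<integral>\<^sup>+y. \<integral>\<^sup>+w. \<integral>\<^sup>+u. ?f (u * y * w powr \<alpha>)
        \<partial>distr M borel U \<partial>distr M borel G \<partial>distr M borel Y)"
      using M.nn_integral_indep_triple[OF indep, of "\<lambda>(u, y, w). ?f (u * y * w powr \<alpha>)"] by simp
    also have "\<dots> = (\<integral>\<^sup>+y. \<integral>\<^sup>+w. c * E w * ennreal (w powr \<alpha>) * J y w \<partial>lborel \<partial>distr M borel Y)"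
      unfolding distr_U distr_G by (subst nn_integral_density) (auto simp: gamma J_def)
    also have "\<dots> = (\<integral>\<^sup>+s. ennreal (S s powr - \<alpha>) / m *
        (\<integral>\<^sup>+w. c * E w * ennreal (w powr \<alpha>) * J (S s powr - \<alpha>) w \<partial>lborel) \<partial>N)"
      unfolding distr_length_biased[OF Y] m_def[symmetric]
      by (simp add: nn_integral_density nn_integral_distr)
    also have "\<dots> = (\<integral>\<^sup>+s. c / m *
        (\<integral>\<^sup>+w. E w * (\<integral>\<^sup>+x. ?f x * T (S s powr - \<alpha> * w powr \<alpha>) x \<partial>lborel)
          \<partial>lborel) \<partial>N)"
      using scale[of "S _ powr - \<alpha>"]
      by (intro nn_integral_cong) (simp add: divide_ennreal_def mult_ac)
    also have "\<dots> = c / m * (\<integral>\<^sup>+s. \<integral>\<^sup>+w. \<integral>\<^sup>+x.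
        E w * (?f x * T (S s powr - \<alpha> * w powr \<alpha>) x) \<partial>lborel \<partial>lborel \<partial>N)"
      by (simp add: nn_integral_cmult)
    \<comment> \<open>Two exchanges bring \<open>x\<close> outermost. The indicator of
      \<open>A\<close> then factors out and the inner double integral is the tail at
      \<open>x\<close> of the product of S powr - \<alpha> and an exponential variable to the power
      \<alpha>.\<close>
    also have "(\<integral>\<^sup>+s. \<integral>\<^sup>+w. \<integral>\<^sup>+x.
        E w * (?f x * T (S s powr - \<alpha> * w powr \<alpha>) x) \<partial>lborel \<partial>lborel \<partial>N) =
        (\<integral>\<^sup>+s. \<integral>\<^sup>+x. \<integral>\<^sup>+w.
        E w * (?f x * T (S s powr - \<alpha> * w powr \<alpha>) x) \<partial>lborel \<partial>lborel \<partial>N)"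
      by (intro nn_integral_cong lborel_pair.Fubini') measurable
    also have "\<dots> = (\<integral>\<^sup>+x. \<integral>\<^sup>+s. \<integral>\<^sup>+w.
        E w * (?f x * T (S s powr - \<alpha> * w powr \<alpha>) x) \<partial>lborel \<partial>N \<partial>lborel)"
      by (rule NL.Fubini'[symmetric]) measurable
    also have "\<dots> = (\<integral>\<^sup>+x. ?f x * (\<integral>\<^sup>+s. \<integral>\<^sup>+w.
        E w * T (S s powr - \<alpha> * w powr \<alpha>) x \<partial>lborel \<partial>N) \<partial>lborel)"
      by (simp add: mult.left_commute[of "E _" "?f _"] nn_integral_cmult)
    also have "\<dots> = (\<integral>\<^sup>+x. ennreal (exponential_density 1 x) * ?f x \<partial>lborel)"
    \<comment> \<open>The point 0 is discarded: there \<open>T\<close> is 0 while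
      \<open>exponential_density 1\<close> equals 1.\<close>
    proof (rule nn_integral_cong_AE, use AE_lborel_singleton[of 0] in eventually_elim)
      fix x :: real assume "x \<noteq> 0"
      show "?f x * (\<integral>\<^sup>+s. \<integral>\<^sup>+w. E w * T (S s powr - \<alpha> * w powr \<alpha>) x
          \<partial>lborel \<partial>N) = ennreal (exponential_density 1 x) * ?f x"
        using \<open>x \<noteq> 0\<close> nn_integral_stable_exp_tail[OF S spaces(2) alpha(1), of x]
        by (cases "0 < x") (auto simp: E_def T_def exponential_density_def mult.commute)
    qed
    also have "\<dots> = emeasure (distr L borel e) A"
      unfolding distr_e by (simp add: emeasure_density)
    finally show ?thesis .
  qed
  \<comment> \<open>Take the whole line for \<open>A\<close>: both measures have mass 1. This
    recovers m = 1 / Gamma (\<alpha> + 1), the first moment of S powr - \<alpha>.\<close>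
  have "c / m = 1"
    using main[of UNIV] M.prob_space_distr[of W borel] L.prob_space_distr[of e borel]
    by (auto dest!: prob_space.emeasure_space_1)
  then show ?thesis
    using main unfolding W_def by (intro measure_eqI) auto
qed

end
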